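(* Let $c,b\ge2$ be integers, put $\alpha=\log_b c$, and suppose that $q\alpha-p=\varepsilon>0$ with $q\in\mathbb Z_{\ge1}$, $p\in\mathbb Z$. Define $$\varrho=\frac{c^q}{b^p}=b^\varepsilon>1,\qquad x=\frac q{\varrho-1},\qquad M=\lfloor x\rfloor,$$ and assume $M\ge1$. Then necessarily $p\ge0$, and the half-open intervals $$J_0=[M,M+1),\qquad J_1=\left[\frac{M+q}{\varrho},\frac{M+q+1}{\varrho}\right)$$ satisfy $J_1\subseteq J_0$ and $|J_1|=\varrho^{-1}$. For every $K\in\mathbb Z$ one has the exact equivalence $$(M+q)b^{K+p}\le c^{M+q}<(M+q+1)b^{K+p}\quad\Longleftrightarrow\quad\frac{c^M}{b^K}\in J_1.$$ Consequently, $$M+q\in\mathcal S_{c,b}\quad\Longrightarrow\quad M\in\mathcal S_{c,b}.$$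
   Context: $\mathcal S_{c,b}$ is the set of integers $m\ge1$ for which there is an integer $k\ge0$ with $mb^k\le c^m<(m+1)b^k$. *)

theory Defs
  imports "HOL-Analysis.Analysis"
begin

text \<open>For \<open>b \<ge> 2\<close>, membership of \<open>m\<close> says that the base-\<open>b\<close> expansion of \<open>c ^ m\<close> begins
  with that of \<open>m\<close>. All inequalities are between natural numbers.\<close>

definition leading_set :: "nat \<Rightarrow> nat \<Rightarrow> nat set" where
  "leading_set c b = {m. 1 \<le> m \<and> (\<exists>k::nat. m * b ^ k \<le> c ^ m \<and> c ^ m < (m + 1) * b ^ k)}"

end

theory Submission
  imports Defs
begin

text \<open>Raising the exponent from \<open>M\<close> to \<open>M + q\<close> multiplies \<open>c ^ M\<close> by \<open>c ^ q = \<rho> * b powi p\<close>. Up to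
  a power of \<open>b\<close>, the leading-digit condition for \<open>M + q\<close> is therefore the condition for \<open>M\<close> with
  the interval \<open>[M + q, M + q + 1)\<close> shrunk by the factor \<open>\<rho>\<close>, and this shrunk interval is \<open>J1\<close>.
  The number \<open>x = q / (\<rho> - 1)\<close> is the fixed point of the map \<open>t \<mapsto> (t + q) / \<rho>\<close>, which contracts
  towards \<open>x\<close>. As \<open>M \<le> x < M + 1\<close>, it does not move \<open>M\<close> down or \<open>M + 1\<close> up, so \<open>J1\<close>
  lies in \<open>J0 = [M, M + 1)\<close>.

  The signs of the two exponents of \<open>b\<close> come from one remark: since \<open>c ^ m \<ge> m + 1\<close>, a quotient
  \<open>c ^ m / b powi K\<close> that is at most \<open>m + 1\<close> has \<open>K \<ge> 0\<close>. For \<open>m = q\<close> the quotient with \<open>K = p\<close> is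
  \<open>\<rho>\<close>, and \<open>x \<ge> M \<ge> 1\<close> gives \<open>\<rho> \<le> q + 1\<close>; so \<open>p\<close> is not negative. For \<open>m = M\<close> the quotient lies in
  \<open>J0\<close>, so the exponent left for \<open>M\<close> after subtracting \<open>p\<close> is a natural number, as the leading set
  requires.\<close>

lemma Suc_le_power_of_ge_2:
  assumes "c \<ge> (2::nat)"
  shows "real n + 1 \<le> real c ^ n"
proof -
  have "n < c ^ n"
    using assms by (intro power_gt_expt) simp
  then have "real (n + 1) \<le> real (c ^ n)"
    by (simp only: of_nat_le_iff)
  then show ?thesis
    by simp
qed

text \<open>A negative exponent \<open>K\<close> would turn the division into multiplication by at least \<open>b > 1\<close>, and
  \<open>c ^ m\<close> already reaches \<open>m + 1\<close>.\<close>

lemma exponent_nonneg_of_quotient_le: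
  assumes "c \<ge> (2::nat)" "b \<ge> (2::nat)" "real c ^ m / real b powi K \<le> real m + 1"
  shows "K \<ge> 0"
proof (rule ccontr)
  assume "\<not> K \<ge> 0"
  then have eq: "real c ^ m / real b powi K = real c ^ m * real b ^ nat (- K)"
    by (simp add: power_int_def field_simps)
  have "1 < real b ^ nat (- K)"
    using assms(2) \<open>\<not> K \<ge> 0\<close> by (intro one_less_power) auto
  then have "real c ^ m * 1 < real c ^ m * real b ^ nat (- K)"
    using assms(1) by (intro mult_strict_left_mono) auto
  then have "real m + 1 < real c ^ m / real b powi K"
    using Suc_le_power_of_ge_2[OF assms(1), of m] unfolding eq by linarith
  with assms(3) show False
    by simp
qed

text \<open>The exponent of \<open>b\<close> may range over all integers, so that it can be shifted freely.\<close>

lemma mem_leading_set_iff_quotient: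
  assumes "c \<ge> 2" "b \<ge> 2"
  shows "m \<in> leading_set c b \<longleftrightarrow>
    1 \<le> m \<and> (\<exists>K::int. real c ^ m / real b powi K \<in> {real m ..< real m + 1})"
proof -
  have nat_exponent: "m * b ^ k \<le> c ^ m \<and> c ^ m < (m + 1) * b ^ k \<longleftrightarrow>
      real c ^ m / real b powi int k \<in> {real m ..< real m + 1}" for k
  proof -
    have pos: "real b ^ k > 0"
      using assms(2) by simp
    have "m * b ^ k \<le> c ^ m \<and> c ^ m < (m + 1) * b ^ k \<longleftrightarrow>
        real (m * b ^ k) \<le> real (c ^ m) \<and> real (c ^ m) < real ((m + 1) * b ^ k)"
      by (simp only: of_nat_le_iff of_nat_less_iff)
    also have "\<dots> \<longleftrightarrow> real c ^ m / real b powi int k \<in> {real m ..< real m + 1}"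
      using pos by (simp add: pos_le_divide_eq pos_divide_less_eq algebra_simps)
    finally show ?thesis .
  qed
  have "(\<exists>k. real c ^ m / real b powi int k \<in> {real m ..< real m + 1}) \<longleftrightarrow>
      (\<exists>K. real c ^ m / real b powi K \<in> {real m ..< real m + 1})"
  proof
    assume "\<exists>K. real c ^ m / real b powi K \<in> {real m ..< real m + 1}"
    then obtain K where K: "real c ^ m / real b powi K \<in> {real m ..< real m + 1}" ..
    have "K \<ge> 0"
      using K by (intro exponent_nonneg_of_quotient_le[OF assms, of m]) simp
    with K show "\<exists>k. real c ^ m / real b powi int k \<in> {real m ..< real m + 1}"
      by (intro exI[of _ "nat K"]) simp
  qed blast
  then show ?thesis
    by (simp only: leading_set_def mem_Collect_eq nat_exponent)
qed

text \<open>For \<open>\<rho> > 1\<close> and \<open>x = q / (\<rho> - 1)\<close>, the last two hypotheses say \<open>M \<le> x \<le> M + 1\<close>: the interval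
  surrounds the fixed point \<open>x\<close> of the contraction \<open>t \<mapsto> (t + q) / \<rho>\<close>, which then maps it into itself.\<close>

lemma contracted_interval_subset:
  fixes \<rho> q M :: real
  assumes "\<rho> > 0" "M * (\<rho> - 1) \<le> q" "q \<le> (M + 1) * (\<rho> - 1)"
  shows "{(M + q) / \<rho> ..< (M + q + 1) / \<rho>} \<subseteq> {M ..< M + 1}"
proof -
  have "M \<le> (M + q) / \<rho>" "(M + q + 1) / \<rho> \<le> M + 1"
    using assms by (simp_all add: pos_le_divide_eq pos_divide_le_eq algebra_simps)
  then show ?thesis
    by auto
qed

theorem theorem5p23:
  fixes c b q M :: nat and p :: int and \<alpha> \<epsilon> \<rho> x :: real and J0 J1 :: "real set"
  assumes c: "c \<ge> 2" and b: "b \<ge> 2" and q: "q \<ge> 1"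
    and \<alpha>: "\<alpha> = log (real b) (real c)"
    and \<epsilon>: "real q * \<alpha> - real_of_int p = \<epsilon>" "\<epsilon> > 0"
    and \<rho>: "\<rho> = real c ^ q / real b powi p"
    and x: "x = real q / (\<rho> - 1)"
    and M: "int M = \<lfloor>x\<rfloor>" "M \<ge> 1"
    and J0: "J0 = {real M ..< real M + 1}"
    and J1: "J1 = {(real M + real q) / \<rho> ..< (real M + real q + 1) / \<rho>}"
  shows "\<rho> = real b powr \<epsilon> \<and> \<rho> > 1 \<and>
    p \<ge> 0 \<and>
    J1 \<subseteq> J0 \<and> measure lborel J1 = inverse \<rho> \<and>
    (\<forall>K::int.
      (real (M + q) * real b powi (K + p) \<le> real c ^ (M + q) \<and>
       real c ^ (M + q) < real (M + q + 1) * real b powi (K + p))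
      \<longleftrightarrow> real c ^ M / real b powi K \<in> J1) \<and>
    (M + q \<in> leading_set c b \<longrightarrow> M \<in> leading_set c b)"
proof -
  have bpos: "real b powi j > 0" for j
    using b by simp
  have cq: "real c ^ q = \<rho> * real b powi p"
    using b by (simp add: \<rho>)

  have \<rho>_powr: "\<rho> = real b powr \<epsilon>"
  proof -
    have "real b powr \<epsilon> = real b powr (\<alpha> * real q) / real b powr real_of_int p"
      by (simp add: \<epsilon>(1)[symmetric] powr_diff mult.commute)
    also have "real b powr (\<alpha> * real q) = real c ^ q"
      using b c by (simp add: \<alpha> powr_powr[symmetric] powr_realpow)
    also have "real b powr real_of_int p = real b powi p"
      using b by (simp add: powr_real_of_int')
    finally show ?thesis
      by (simp add: \<rho>)
  qed
  have \<rho>_gt: "\<rho> > 1"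
    unfolding \<rho>_powr using b \<epsilon>(2) by simp

  have "real M \<le> x" "x < real M + 1"
    using M(1) by linarith+
  then have M_lower: "real M * (\<rho> - 1) \<le> real q" and M_upper: "real q \<le> (real M + 1) * (\<rho> - 1)"
    using \<rho>_gt by (simp_all add: x pos_le_divide_eq pos_divide_less_eq)

  have p_nonneg: "p \<ge> 0"
  proof -
    have "1 * (\<rho> - 1) \<le> real M * (\<rho> - 1)"
      using M(2) \<rho>_gt by (intro mult_right_mono) auto
    then have "real c ^ q / real b powi p \<le> real q + 1"
      using M_lower unfolding \<rho>[symmetric] by simp
    then show ?thesis
      by (rule exponent_nonneg_of_quotient_le[OF c b])
  qed

  have sub: "J1 \<subseteq> J0"
    unfolding J0 J1 using contracted_interval_subset[OF _ M_lower M_upper] \<rho>_gt by simp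

  have len: "measure lborel J1 = inverse \<rho>"
  proof -
    have "(real M + real q) / \<rho> \<le> (real M + real q + 1) / \<rho>"
      using \<rho>_gt by (intro divide_right_mono) auto
    then show ?thesis
      unfolding J1 by (simp add: diff_divide_distrib[symmetric] inverse_eq_divide)
  qed

  have shift: "real (M + q) * real b powi (K + p) \<le> real c ^ (M + q) \<and>
      real c ^ (M + q) < real (M + q + 1) * real b powi (K + p)
      \<longleftrightarrow> real c ^ M / real b powi K \<in> J1" for K
  proof -
    define y where "y = real c ^ M / real b powi K"
    have B: "real b powi (K + p) = real b powi K * real b powi p"
      using b by (simp add: power_int_add)
    have C: "real c ^ (M + q) = (y * \<rho>) * real b powi (K + p)"
      using b by (simp add: y_def power_add cq B)
    show ?thesis
      using bpos[of "K + p"] \<rho>_gt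
      by (simp add: C J1 y_def[symmetric] pos_divide_le_eq pos_less_divide_eq add.commute)
  qed

  have "M \<in> leading_set c b" if mem: "M + q \<in> leading_set c b"
  proof -
    obtain k where "(M + q) * b ^ k \<le> c ^ (M + q)" "c ^ (M + q) < (M + q + 1) * b ^ k"
      using mem unfolding leading_set_def by blast
    then have "real ((M + q) * b ^ k) \<le> real (c ^ (M + q))"
      "real (c ^ (M + q)) < real ((M + q + 1) * b ^ k)"
      by (simp_all only: of_nat_le_iff of_nat_less_iff)
    then have "real c ^ M / real b powi (int k - p) \<in> J1"
      by (subst shift[symmetric]) (simp add: algebra_simps)
    with sub have "real c ^ M / real b powi (int k - p) \<in> {real M ..< real M + 1}"
      unfolding J0 by blast
    then show ?thesis
      using mem_leading_set_iff_quotient[OF c b, of M] M(2) by auto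
  qed
  with \<rho>_powr \<rho>_gt p_nonneg sub len shift show ?thesis
    by blast
qed

end
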